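(* The filter topology on a poc set $P$ is quasi compact if and only if $P$ is of type $\omega$.
   Context: A poc set is a partially ordered set $P$ with a smallest element $0$ and an involution $^*$ such that $a\le b\Rightarrow b^*\le a^*$, and $a\le a^*\Rightarrow a=0$; standing convention: $0\ne0^*$. An ultra filter in $P$ is an upper set $U\subset P$ such that $P$ is the disjoint union of $U$ and $U^*=\{a^*: a\in U\}$. The filter topology on $P$ is the topology with open subbasis consisting of all sets $U$ and $U^*=P\setminus U$, where $U$ ranges over the ultra filters of $P$. Quasi compact means every open cover has a finite subcover. Two elements $a,b\in P$ are nested if $a$ is comparable with $b$ or with $b^*$, and transverse otherwise. A subset is transverse if any two distinct elements of it are transverse. $P$ is of type $\omega$ if every chain in $P$ is finite and every transverse subset of $P$ is finite. *)

theory Defs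
  imports "HOL-Analysis.Abstract_Topology"
begin

locale poc_set =
  fixes P :: "'a set"
    and le :: "'a \<Rightarrow> 'a \<Rightarrow> bool"  (infix "\<sqsubseteq>" 50)
    and zero :: 'a
    and star :: "'a \<Rightarrow> 'a"
  assumes reflp_on_le: "reflp_on P (\<sqsubseteq>)"
    and antisymp_on_le: "antisymp_on P (\<sqsubseteq>)"
    and transp_on_le: "transp_on P (\<sqsubseteq>)"
    and zero_closed: "zero \<in> P"
    and zero_least: "a \<in> P \<Longrightarrow> zero \<sqsubseteq> a"
    and star_closed: "a \<in> P \<Longrightarrow> star a \<in> P"
    and star_star: "a \<in> P \<Longrightarrow> star (star a) = a"
    and star_antimono: "\<lbrakk>a \<in> P; b \<in> P; a \<sqsubseteq> b\<rbrakk> \<Longrightarrow> star b \<sqsubseteq> star a"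
    and le_star_self: "\<lbrakk>a \<in> P; a \<sqsubseteq> star a\<rbrakk> \<Longrightarrow> a = zero"
    and zero_neq_star_zero: "zero \<noteq> star zero"
begin

definition upper_set :: "'a set \<Rightarrow> bool" where
  "upper_set U \<longleftrightarrow> U \<subseteq> P \<and> (\<forall>a\<in>U. \<forall>b\<in>P. a \<sqsubseteq> b \<longrightarrow> b \<in> U)"

definition ultra_filter :: "'a set \<Rightarrow> bool" where
  "ultra_filter U \<longleftrightarrow> upper_set U \<and> U \<union> star ` U = P \<and> U \<inter> star ` U = {}"

definition filter_subbasis :: "'a set set" where
  "filter_subbasis = {U. ultra_filter U} \<union> {star ` U | U. ultra_filter U}"

text \<open>The topology on \<^term>\<open>P\<close> with the given subbasis. Intersections are taken relative to
  \<^term>\<open>P\<close>, so the empty intersection is \<^term>\<open>P\<close> and \<^term>\<open>P\<close> is the underlying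
  space by construction.\<close>

definition filter_topology :: "'a topology" where
  "filter_topology =
    topology (arbitrary union_of
      (finite intersection_of (\<lambda>V. V \<in> filter_subbasis) relative_to P))"

lemma openin_filter_topology:
  "openin filter_topology =
    arbitrary union_of (finite intersection_of (\<lambda>V. V \<in> filter_subbasis) relative_to P)"
  unfolding filter_topology_def by (simp add: istopology_subbase)

lemma topspace_filter_topology: "topspace filter_topology = P"
  unfolding filter_topology_def by (rule topspace_subbase)

definition comparable :: "'a \<Rightarrow> 'a \<Rightarrow> bool" where
  "comparable a b \<longleftrightarrow> a \<sqsubseteq> b \<or> b \<sqsubseteq> a"

definition nested :: "'a \<Rightarrow> 'a \<Rightarrow> bool" where
  "nested a b \<longleftrightarrow> comparable a b \<or> comparable a (star b)"

definition transverse :: "'a \<Rightarrow> 'a \<Rightarrow> bool" where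
  "transverse a b \<longleftrightarrow> \<not> nested a b"

definition type_omega :: bool where
  "type_omega \<longleftrightarrow>
    (\<forall>C. C \<subseteq> P \<and> totalp_on C (\<sqsubseteq>) \<longrightarrow> finite C) \<and>
    (\<forall>T. T \<subseteq> P \<and> pairwise transverse T \<longrightarrow> finite T)"

end

end

theory Submission
  imports Defs "HOL-Analysis.Function_Topology" "HOL-Library.Ramsey"
begin

text \<open>
  Both conditions are equivalent to a third one: \<open>U \<inter> star ` V\<close> is finite for all ultra
  filters \<open>U\<close> and \<open>V\<close>.

  For the topological side, the ultra filters and their stars are clopen, and every ultra filter
  contains \<open>star zero\<close> but not \<open>zero\<close>. Hence a cover by subbasic sets must use some \<open>star ` V\<close>
  to cover \<open>zero\<close> and some ultra filter \<open>U\<close> to cover \<open>star zero\<close>, and these two leave only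
  \<open>V \<inter> star ` U\<close> uncovered. If that set is always finite, then Alexander's subbase theorem
  gives quasi compactness. Conversely \<open>U \<inter> star ` V\<close> is closed, and it is discrete: each of
  its points \<open>p\<close> is cut out by an ultra filter that contains \<open>p\<close> and omits the elements not above
  \<open>p\<close>, together with one that omits \<open>p\<close> and contains the elements not below \<open>p\<close>. A discrete
  closed subset of a quasi compact space is finite.

  For the combinatorial side, a subset of \<open>P\<close> lies in some \<open>U \<inter> star ` V\<close> exactly if it contains
  no \<open>x\<close>, \<open>y\<close> with \<open>x \<sqsubseteq> star y\<close> or \<open>star x \<sqsubseteq> y\<close>. Chains and transverse sets have this property
  once \<open>zero\<close> and \<open>star zero\<close> are discarded. Conversely, within such a set being nested just means
  being comparable, so that Ramsey's theorem finds an infinite chain or an infinite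
  transverse set in it as soon as it is infinite.
\<close>

context poc_set
begin

section \<open>Extension to ultra filters\<close>

lemma le_trans:
  "\<lbrakk>a \<sqsubseteq> b; b \<sqsubseteq> c; a \<in> P; b \<in> P; c \<in> P\<rbrakk> \<Longrightarrow> a \<sqsubseteq> c"
  using transp_on_le by (meson transp_onD)

lemma le_refl: "a \<in> P \<Longrightarrow> a \<sqsubseteq> a"
  using reflp_on_le by (meson reflp_onD)

lemma le_antisym: "\<lbrakk>a \<sqsubseteq> b; b \<sqsubseteq> a; a \<in> P; b \<in> P\<rbrakk> \<Longrightarrow> a = b"
  using antisymp_on_le by (meson antisymp_onD)

lemma le_zero: "\<lbrakk>a \<in> P; a \<sqsubseteq> zero\<rbrakk> \<Longrightarrow> a = zero"
  using le_antisym zero_closed zero_least by blast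

lemma le_star_commute: "\<lbrakk>a \<in> P; b \<in> P\<rbrakk> \<Longrightarrow> a \<sqsubseteq> star b \<longleftrightarrow> b \<sqsubseteq> star a"
  using star_antimono star_closed star_star by metis

lemma star_le_commute: "\<lbrakk>a \<in> P; b \<in> P\<rbrakk> \<Longrightarrow> star a \<sqsubseteq> b \<longleftrightarrow> star b \<sqsubseteq> a"
  using star_antimono star_closed star_star by metis

lemma star_le_self: "\<lbrakk>a \<in> P; star a \<sqsubseteq> a\<rbrakk> \<Longrightarrow> a = star zero"
  using le_star_self[of "star a"] star_closed star_star by metis

lemma star_le_star_iff:
  "\<lbrakk>a \<in> P; b \<in> P\<rbrakk> \<Longrightarrow> star a \<sqsubseteq> star b \<longleftrightarrow> b \<sqsubseteq> a"
  using star_antimono star_closed star_star by metis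

lemma mem_star_image: "\<lbrakk>S \<subseteq> P; a \<in> P\<rbrakk> \<Longrightarrow> a \<in> star ` S \<longleftrightarrow> star a \<in> S"
  by (metis (no_types, lifting) image_iff star_star subsetD)

text \<open>No two elements of an ultra filter satisfy \<open>x \<sqsubseteq> star y\<close>, since the upper bound
  \<open>star y\<close> would belong to it together with \<open>y\<close>. This obstruction is the only one to
  extending a set to an ultra filter.\<close>

definition consistent :: "'a set \<Rightarrow> bool" where
  "consistent S \<longleftrightarrow> S \<subseteq> P \<and> (\<forall>x\<in>S. \<forall>y\<in>S. \<not> x \<sqsubseteq> star y)"

lemma consistent_subset: "\<lbrakk>consistent S; T \<subseteq> S\<rbrakk> \<Longrightarrow> consistent T"
  unfolding consistent_def by blast

lemma consistent_insert:
  assumes "consistent S" "a \<in> P" "a \<noteq> zero" "\<And>y. y \<in> S \<Longrightarrow> \<not> a \<sqsubseteq> star y"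
  shows "consistent (insert a S)"
proof -
  have "\<not> a \<sqsubseteq> star a" using assms le_star_self by blast
  moreover have "\<not> y \<sqsubseteq> star a" if "y \<in> S" for y
    using that assms le_star_commute unfolding consistent_def by blast
  ultimately show ?thesis using assms unfolding consistent_def by auto
qed

text \<open>An obstruction \<open>b \<sqsubseteq> star y\<close> to adding \<open>b\<close> to \<open>M\<close> is also an obstruction for every
  \<open>a\<close> below \<open>b\<close>, so \<open>M\<close> is an upper set. If neither \<open>a\<close> nor \<open>star a\<close> could be added to
  \<open>M\<close>, then \<open>z \<sqsubseteq> a \<sqsubseteq> star y\<close> for some \<open>y\<close> and \<open>z\<close> in \<open>M\<close>, contradicting consistency.
  As \<open>zero\<close> itself can never be added, the pair of \<open>zero\<close> and \<open>star zero\<close> is treated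
  separately.\<close>

lemma maximal_consistent_imp_ultra_filter:
  assumes M: "consistent M" and max: "\<And>X. \<lbrakk>consistent X; M \<subseteq> X\<rbrakk> \<Longrightarrow> X = M"
  shows "ultra_filter M"
proof -
  have MP: "M \<subseteq> P" and ncon: "\<And>x y. \<lbrakk>x \<in> M; y \<in> M\<rbrakk> \<Longrightarrow> \<not> x \<sqsubseteq> star y"
    using M unfolding consistent_def by auto
  have add: "\<exists>y\<in>M. a \<sqsubseteq> star y" if "a \<in> P" "a \<noteq> zero" "a \<notin> M" for a
    using consistent_insert[OF M that(1,2)] max[of "insert a M"] that(3) by blast
  have zM: "zero \<notin> M"
    using ncon zero_least star_closed zero_closed by blast
  have upper: "b \<in> M" if ab: "a \<in> M" "b \<in> P" "a \<sqsubseteq> b" for a b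
  proof (rule ccontr)
    assume "b \<notin> M"
    moreover have "b \<noteq> zero" using that le_zero zM MP by blast
    ultimately obtain y where "y \<in> M" "b \<sqsubseteq> star y" using add ab(2) by blast
    then show False using ab ncon MP le_trans star_closed by (meson subsetD)
  qed
  have top: "star zero \<in> M"
  proof (rule ccontr)
    assume "star zero \<notin> M"
    then obtain y where "y \<in> M" "star zero \<sqsubseteq> star y"
      using add zero_neq_star_zero star_closed zero_closed by metis
    then show False using zM le_zero star_le_star_iff MP zero_closed by blast
  qed
  have total: "a \<in> M \<or> star a \<in> M" if a: "a \<in> P" for a
  proof (rule ccontr)
    assume neg: "\<not> (a \<in> M \<or> star a \<in> M)"
    then have "a \<noteq> zero" "star a \<noteq> zero"
      using top star_star[OF a] by auto
    then obtain y z where "y \<in> M" "a \<sqsubseteq> star y" "z \<in> M" "star a \<sqsubseteq> star z"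
      using add neg a star_closed by meson
    then show False using ncon star_le_star_iff le_trans a star_closed MP by (meson subsetD)
  qed
  have "M \<union> star ` M = P"
    using total MP star_closed mem_star_image[OF MP] by blast
  moreover have "M \<inter> star ` M = {}"
    using ncon MP star_closed le_refl by blast
  ultimately show ?thesis
    using upper MP unfolding ultra_filter_def upper_set_def by blast
qed

lemma consistent_imp_subset_ultra_filter:
  assumes "consistent S"
  obtains U where "ultra_filter U" "S \<subseteq> U"
proof -
  let ?A = "{X. consistent X \<and> S \<subseteq> X}"
  have "\<exists>M\<in>?A. \<forall>X\<in>?A. M \<subseteq> X \<longrightarrow> X = M"
  proof (rule subset_Zorn_nonempty)
    show "?A \<noteq> {}" using assms by blast
    show "\<Union>C \<in> ?A" if "C \<noteq> {}" and ch: "subset.chain ?A C" for C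
    proof -
      have sub: "C \<subseteq> ?A" using ch by (simp add: subset_chain_def)
      have "\<not> x \<sqsubseteq> star y" if xy: "x \<in> \<Union>C" "y \<in> \<Union>C" for x y
      proof -
        obtain X Y where "X \<in> C" "Y \<in> C" "x \<in> X" "y \<in> Y" using xy by blast
        moreover have "X \<subseteq> Y \<or> Y \<subseteq> X"
          using ch \<open>X \<in> C\<close> \<open>Y \<in> C\<close> unfolding subset_chain_def by blast
        ultimately show ?thesis using sub unfolding consistent_def by blast
      qed
      then show ?thesis using sub \<open>C \<noteq> {}\<close> unfolding consistent_def by blast
    qed
  qed
  then obtain M where M: "M \<in> ?A" and max: "\<And>X. \<lbrakk>X \<in> ?A; M \<subseteq> X\<rbrakk> \<Longrightarrow> X = M"
    by (elim bexE) simp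

  have "ultra_filter M"
    using M max by (intro maximal_consistent_imp_ultra_filter) auto
  with M show ?thesis using that[of M] by simp
qed

lemma ultra_filter_subset: "ultra_filter U \<Longrightarrow> U \<subseteq> P"
  unfolding ultra_filter_def by blast

lemma ultra_filter_consistent:
  assumes "ultra_filter U"
  shows "consistent U"
proof -
  have "\<not> x \<sqsubseteq> star y" if "x \<in> U" "y \<in> U" for x y
  proof
    assume "x \<sqsubseteq> star y"
    moreover have "star y \<in> P" using assms that ultra_filter_subset star_closed by blast
    ultimately have "star y \<in> U"
      using assms that unfolding ultra_filter_def upper_set_def by blast
    then show False using assms that unfolding ultra_filter_def by blast
  qed
  then show ?thesis using assms ultra_filter_subset unfolding consistent_def by blast
qed

lemma star_image_ultra_filter: "ultra_filter U \<Longrightarrow> star ` U = P - U"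
  unfolding ultra_filter_def by blast

lemma zero_notin_ultra_filter: "ultra_filter U \<Longrightarrow> zero \<notin> U"
  using ultra_filter_consistent zero_least star_closed zero_closed
  unfolding consistent_def by blast

lemma star_zero_in_ultra_filter: "ultra_filter U \<Longrightarrow> star zero \<in> U"
  using zero_notin_ultra_filter[of U] star_image_ultra_filter[of U]
    mem_star_image[OF ultra_filter_subset, of U zero] zero_closed by simp

section \<open>Subsets of differences of ultra filters\<close>

text \<open>Extending both sets to ultra filters shows that the biconsistent sets are exactly the subsets
  of the sets \<open>U \<inter> star ` V\<close> with \<open>U\<close> and \<open>V\<close> ultra filters.\<close>

definition biconsistent :: "'a set \<Rightarrow> bool" where
  "biconsistent S \<longleftrightarrow> consistent S \<and> consistent (star ` S)"

lemma biconsistent_iff: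
  "biconsistent S \<longleftrightarrow> S \<subseteq> P \<and> (\<forall>x\<in>S. \<forall>y\<in>S. \<not> x \<sqsubseteq> star y \<and> \<not> star x \<sqsubseteq> y)"
proof (cases "S \<subseteq> P")
  case True
  then have "star ` S \<subseteq> P" using star_closed by blast
  moreover have "star (star y) = y" if "y \<in> S" for y using True that star_star by blast
  ultimately show ?thesis using True unfolding biconsistent_def consistent_def by auto
next
  case False
  then show ?thesis unfolding biconsistent_def consistent_def by blast
qed

lemma ultra_filter_Int_star_biconsistent:
  assumes U: "ultra_filter U" and V: "ultra_filter V"
  shows "biconsistent (U \<inter> star ` V)"
proof -
  have "star ` (U \<inter> star ` V) \<subseteq> V"
    using star_star ultra_filter_subset[OF V] by auto
  then show ?thesis
    unfolding biconsistent_def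
    using consistent_subset[OF ultra_filter_consistent[OF U]]
      consistent_subset[OF ultra_filter_consistent[OF V]] by simp
qed

lemma biconsistent_subset_Int_star:
  assumes "biconsistent S"
  obtains U V where "ultra_filter U" "ultra_filter V" "S \<subseteq> U \<inter> star ` V"
proof -
  obtain U V where UV: "ultra_filter U" "S \<subseteq> U" "ultra_filter V" "star ` S \<subseteq> V"
    using assms consistent_imp_subset_ultra_filter unfolding biconsistent_def by metis
  moreover have "S \<subseteq> star ` V"
    using UV mem_star_image[OF ultra_filter_subset] ultra_filter_subset by blast
  ultimately show ?thesis using that[of U V] by blast
qed

text \<open>Since \<open>star ` V\<close> is the complement of \<open>V\<close>, the sets here are the differences
  \<open>U - V\<close> of ultra filters.\<close>

definition finite_differences :: bool where
  "finite_differences \<longleftrightarrow> (\<forall>U V. ultra_filter U \<and> ultra_filter V \<longrightarrow> finite (U \<inter> star ` V))"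

lemma finite_differences_iff_finite_biconsistent:
  "finite_differences \<longleftrightarrow> (\<forall>S. biconsistent S \<longrightarrow> finite S)"
proof (intro iffI allI impI)
  fix S assume fd: finite_differences and "biconsistent S"
  then obtain U V where UV: "ultra_filter U" "ultra_filter V" and sub: "S \<subseteq> U \<inter> star ` V"
    using biconsistent_subset_Int_star by metis
  from fd UV have "finite (U \<inter> star ` V)"
    unfolding finite_differences_def by simp
  then show "finite S" using sub by (rule rev_finite_subset)
next
  assume "\<forall>S. biconsistent S \<longrightarrow> finite S"
  then show finite_differences
    unfolding finite_differences_def by (simp add: ultra_filter_Int_star_biconsistent)
qed

section \<open>Type omega\<close>

text \<open>In a chain, \<open>x \<sqsubseteq> star y\<close> implies \<open>m \<sqsubseteq> star m\<close> for the smaller one \<open>m\<close> of \<open>x\<close> and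
  \<open>y\<close>, which forces \<open>m = zero\<close>; dually for \<open>star x \<sqsubseteq> y\<close>.\<close>

lemma chain_biconsistent:
  assumes CP: "C \<subseteq> P" and ch: "totalp_on C (\<sqsubseteq>)"
  shows "biconsistent (C - {zero, star zero})"
  unfolding biconsistent_iff
proof (intro conjI ballI notI)
  show "C - {zero, star zero} \<subseteq> P" using CP by blast
next
  fix x y assume xy: "x \<in> C - {zero, star zero}" "y \<in> C - {zero, star zero}"
  then have P: "x \<in> P" "y \<in> P" and cmp: "x \<sqsubseteq> y \<or> y \<sqsubseteq> x"
    using CP ch le_refl by (auto dest: totalp_onD)
  show False if "x \<sqsubseteq> star y"
  proof -
    have "x \<sqsubseteq> star x \<or> y \<sqsubseteq> star y"
      using that cmp P le_trans star_closed le_star_commute by metis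
    then show False using xy P le_star_self by blast
  qed
  show False if "star x \<sqsubseteq> y"
  proof -
    have "star x \<sqsubseteq> x \<or> star y \<sqsubseteq> y"
      using that cmp P le_trans star_closed star_le_commute by metis
    then show False using xy P star_le_self by blast
  qed
qed

lemma transverse_biconsistent:
  assumes TP: "T \<subseteq> P" and tr: "pairwise transverse T"
  shows "biconsistent (T - {zero, star zero})"
  unfolding biconsistent_iff
proof (intro conjI ballI notI)
  show "T - {zero, star zero} \<subseteq> P" using TP by blast
next
  fix x y assume xy: "x \<in> T - {zero, star zero}" "y \<in> T - {zero, star zero}"
  then have P: "x \<in> P" "y \<in> P" using TP by auto
  have "\<not> nested x y" if "x \<noteq> y"
    using that xy tr unfolding pairwise_def transverse_def by blast
  then have tv: "x \<noteq> y \<Longrightarrow> \<not> x \<sqsubseteq> star y" "x \<noteq> y \<Longrightarrow> \<not> star y \<sqsubseteq> x"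
    unfolding nested_def comparable_def by auto
  show False if "x \<sqsubseteq> star y"
    using that tv xy P le_star_self by blast
  show False if "star x \<sqsubseteq> y"
    using that tv xy P star_le_self star_le_commute by blast
qed

text \<open>Between elements of a biconsistent set the relations \<open>x \<sqsubseteq> star y\<close> and \<open>star y \<sqsubseteq> x\<close> are impossible, so
  being nested reduces to the symmetric relation of being comparable, and Ramsey's theorem for two
  colours applies.\<close>

lemma type_omega_finite_biconsistent:
  assumes om: type_omega and S: "biconsistent S"
  shows "finite S"
proof (rule ccontr)
  assume inf: "infinite S"
  define col :: "'a set \<Rightarrow> nat"
    where "col e = (if \<exists>x y. e = {x, y} \<and> x \<sqsubseteq> y then 0 else 1)" for e
  have col: "col {x, y} = 0 \<longleftrightarrow> comparable x y" for x y
    unfolding col_def comparable_def by (auto simp: doubleton_eq_iff)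
  have "\<forall>x\<in>S. \<forall>y\<in>S. x \<noteq> y \<longrightarrow> col {x, y} < 2"
    unfolding col_def by auto
  from Ramsey2[OF inf this] obtain Y t where Y: "Y \<subseteq> S" "infinite Y"
    and t: "\<forall>x\<in>Y. \<forall>y\<in>Y. x \<noteq> y \<longrightarrow> col {x, y} = t"
    by (elim exE conjE)
  have SP: "S \<subseteq> P"
    and ns: "\<And>x y. \<lbrakk>x \<in> S; y \<in> S\<rbrakk> \<Longrightarrow> \<not> x \<sqsubseteq> star y \<and> \<not> star x \<sqsubseteq> y"
    using S unfolding biconsistent_iff by blast+
  show False
  proof (cases "t = 0")
    case True
    then have "totalp_on Y (\<sqsubseteq>)"
      using t col unfolding comparable_def totalp_on_def by metis
    then show False using om Y SP unfolding type_omega_def by blast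
  next
    case False
    then have "pairwise transverse Y"
      using t col ns Y(1) unfolding pairwise_def transverse_def nested_def
      by (metis comparable_def subsetD)
    then show False using om Y SP unfolding type_omega_def by blast
  qed
qed

lemma type_omega_iff_finite_differences: "type_omega \<longleftrightarrow> finite_differences"
proof
  show "type_omega \<Longrightarrow> finite_differences"
    using type_omega_finite_biconsistent finite_differences_iff_finite_biconsistent by blast
next
  assume fd: finite_differences
  have "finite S" if "biconsistent (S - {zero, star zero})" for S
    using fd that unfolding finite_differences_iff_finite_biconsistent
    by (metis finite.emptyI finite.insertI finite_Diff2)
  then show type_omega
    unfolding type_omega_def using chain_biconsistent transverse_biconsistent by blast
qed

section \<open>Quasi compactness\<close>

lemma openin_subbasis: "W \<in> filter_subbasis \<Longrightarrow> openin filter_topology W"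
proof -
  assume W: "W \<in> filter_subbasis"
  then have "W \<subseteq> P"
    unfolding filter_subbasis_def
    using ultra_filter_subset star_image_ultra_filter by auto
  moreover have "openin filter_topology (P \<inter> W)"
    unfolding openin_filter_topology
    by (intro arbitrary_union_of_inc relative_to_inc finite_intersection_of_inc W)
  ultimately show ?thesis by (simp add: inf_absorb2)
qed

lemma openin_ultra_filter: "ultra_filter U \<Longrightarrow> openin filter_topology U"
  by (rule openin_subbasis) (auto simp: filter_subbasis_def)

lemma openin_star_ultra_filter: "ultra_filter U \<Longrightarrow> openin filter_topology (star ` U)"
  by (rule openin_subbasis) (auto simp: filter_subbasis_def)

lemma closedin_ultra_filter_Int_star:
  assumes "ultra_filter U" "ultra_filter V"
  shows "closedin filter_topology (U \<inter> star ` V)"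
proof -
  have "closedin filter_topology U" "closedin filter_topology (star ` V)"
    using assms openin_ultra_filter openin_star_ultra_filter star_image_ultra_filter
      ultra_filter_subset closedin_def
    unfolding closedin_def topspace_filter_topology by (auto simp: double_diff)
  then show ?thesis by blast
qed

text \<open>Two distinct elements of \<open>P\<close> cannot lie below each other, so an element \<open>s\<close> of \<open>S\<close> with
  \<open>s \<noteq> p\<close> is either not above \<open>p\<close>, and omitted by an ultra filter \<open>U\<close> that contains \<open>p\<close>, or not
  below \<open>p\<close>, and contained in an ultra filter \<open>V\<close> that omits \<open>p\<close>.\<close>

lemma biconsistent_point_isolated:
  assumes S: "biconsistent S" and p: "p \<in> S"
  obtains W where "openin filter_topology W" "S \<inter> W = {p}"
proof -
  have SP: "S \<subseteq> P"
    and ns: "\<And>x y. \<lbrakk>x \<in> S; y \<in> S\<rbrakk> \<Longrightarrow> \<not> x \<sqsubseteq> star y \<and> \<not> star x \<sqsubseteq> y"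
    using S unfolding biconsistent_iff by blast+
  have pP: "p \<in> P" using SP p by blast
  have p0: "p \<noteq> zero"
    using ns p pP zero_least star_closed by blast
  have p1: "star p \<noteq> zero"
    using ns[OF p p] pP zero_least by metis
  let ?A = "{s \<in> S. \<not> p \<sqsubseteq> s}" and ?B = "{s \<in> S. \<not> s \<sqsubseteq> p}"
  have "consistent (insert p (star ` ?A))"
  proof (rule consistent_insert[OF _ pP p0])
    show "consistent (star ` ?A)"
      using S consistent_subset unfolding biconsistent_def by (metis (no_types, lifting) image_mono mem_Collect_eq subsetI)
    show "\<not> p \<sqsubseteq> star y" if "y \<in> star ` ?A" for y
      using that SP star_star by auto
  qed
  then obtain U where U: "ultra_filter U" "insert p (star ` ?A) \<subseteq> U"
    using consistent_imp_subset_ultra_filter by blast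
  have "consistent (insert (star p) ?B)"
  proof (rule consistent_insert[OF _ star_closed[OF pP] p1])
    show "consistent ?B"
      using S consistent_subset unfolding biconsistent_def by (metis (no_types, lifting) mem_Collect_eq subsetI)
    show "\<not> star p \<sqsubseteq> star y" if "y \<in> ?B" for y
      using that SP pP star_le_star_iff by blast
  qed
  then obtain V where V: "ultra_filter V" "insert (star p) ?B \<subseteq> V"
    using consistent_imp_subset_ultra_filter by blast
  let ?W = "U \<inter> star ` V"
  have "p \<in> ?W"
    using U V pP mem_star_image[OF ultra_filter_subset[OF V(1)]] by blast
  moreover have "s = p" if "s \<in> S" "s \<in> ?W" for s
  proof -
    have "s \<notin> ?A"
      using that U star_image_ultra_filter[OF U(1)] mem_star_image[OF ultra_filter_subset[OF U(1)]] SP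
      by blast
    moreover have "s \<notin> ?B"
      using that V star_image_ultra_filter[OF V(1)] by blast
    ultimately show ?thesis using that SP pP le_antisym by blast
  qed
  ultimately have "S \<inter> ?W = {p}" using p by blast
  moreover have "openin filter_topology ?W"
    using U V openin_ultra_filter openin_star_ultra_filter by blast
  ultimately show ?thesis using that by blast
qed

lemma compact_space_imp_finite_differences:
  assumes cpt: "compact_space filter_topology"
  shows finite_differences
  unfolding finite_differences_def
proof (intro allI impI)
  fix U V assume UV: "ultra_filter U \<and> ultra_filter V"
  let ?S = "U \<inter> star ` V"
  have "p \<notin> filter_topology derived_set_of ?S" if p: "p \<in> ?S" for p
  proof -
    obtain W where "openin filter_topology W" "?S \<inter> W = {p}"
      using biconsistent_point_isolated ultra_filter_Int_star_biconsistent[of U V] UV p by metis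
    then show ?thesis unfolding in_derived_set_of by blast
  qed
  then have "?S \<inter> filter_topology derived_set_of ?S = {}"
    by (simp add: disjoint_iff)
  moreover have "compactin filter_topology ?S"
    using closedin_compact_space[OF cpt] closedin_ultra_filter_Int_star UV by blast
  ultimately show "finite ?S"
    using discrete_compactin_eq_finite[of ?S filter_topology] by simp
qed

lemma finite_differences_imp_compact_space:
  assumes fd: finite_differences
  shows "compact_space filter_topology"
proof (rule Alexander_subbase_alt)
  show "topology (arbitrary union_of
      (finite intersection_of (\<lambda>x. x \<in> filter_subbasis) relative_to P)) = filter_topology"
    by (simp add: filter_topology_def)
  have "consistent {}" by (simp add: consistent_def)
  then obtain U where "ultra_filter U" by (rule consistent_imp_subset_ultra_filter)
  then have "U \<in> filter_subbasis" "star ` U \<in> filter_subbasis" "P \<subseteq> U \<union> star ` U"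
    unfolding filter_subbasis_def ultra_filter_def by auto
  then show "P \<subseteq> \<Union>filter_subbasis" by blast
next
  fix C assume sub: "C \<subseteq> filter_subbasis" and cov: "P \<subseteq> \<Union>C"
  obtain A where A: "A \<in> C" "zero \<in> A" using cov zero_closed by blast
  then obtain V where V: "ultra_filter V" "A = star ` V"
    using sub zero_notin_ultra_filter unfolding filter_subbasis_def by blast
  obtain B where B: "B \<in> C" "star zero \<in> B" using cov zero_closed star_closed by blast
  then have U: "ultra_filter B"
    using sub star_zero_in_ultra_filter star_image_ultra_filter
    unfolding filter_subbasis_def by blast
  have "P - (A \<union> B) = V \<inter> star ` B"
    using star_image_ultra_filter U V ultra_filter_subset[OF V(1)] by auto
  then have fin: "finite (P - (A \<union> B))"
    using fd U V unfolding finite_differences_def by simp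
  have "\<forall>x\<in>P. \<exists>D\<in>C. x \<in> D" using cov by blast
  then obtain D where D: "\<And>x. x \<in> P \<Longrightarrow> D x \<in> C \<and> x \<in> D x" by metis
  show "\<exists>C'. finite C' \<and> C' \<subseteq> C \<and> P \<subseteq> \<Union>C'"
  proof (intro exI conjI)
    let ?C' = "{A, B} \<union> D ` (P - (A \<union> B))"
    show "finite ?C'" using fin by simp
    show "?C' \<subseteq> C" using A B D by auto
    show "P \<subseteq> \<Union>?C'" using D by auto
  qed
qed

lemma compact_space_iff_type_omega: "compact_space filter_topology \<longleftrightarrow> type_omega"
  using type_omega_iff_finite_differences compact_space_imp_finite_differences
    finite_differences_imp_compact_space by blast

end

theorem theorem6p13:
  fixes P :: "'a set" and le :: "'a \<Rightarrow> 'a \<Rightarrow> bool"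
    and zero :: 'a and star :: "'a \<Rightarrow> 'a"
  assumes "poc_set P le zero star"
  shows "compact_space (poc_set.filter_topology P le star) \<longleftrightarrow> poc_set.type_omega P le star"
  using assms by (rule poc_set.compact_space_iff_type_omega)

end
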